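(* Let $P\in\mathbb{R}^m$ be a point and $d\in\mathbb{R}^m$ a direction (row vectors), and consider the ray $y=P+td$ $(t\ge0)$. For $j=1,\dots,n+m$ let $$M_j=c^+_j-PA^+_j,\qquad D_j=dA^+_j,\qquad t_j=M_j/D_j\ \ (\text{when } D_j\ne0).$$ (F1) If there is an index $j$ with $D_j=0$ and $M_j>0$, then there is no feasible point on the ray. (F2) If $M_j\le0$ whenever $D_j=0$, set $$t_a=\max_j\{t_j\mid D_j>0\},\qquad t_b=\min_j\{t_j\mid D_j<0\}.$$ If $t_a\le t_b$, then there is a feasible interval $[Q_a,Q_b]$ on the ray, where $Q_a=P+t_ad$ and $Q_b=P+t_bd$.
   Context: Let $A\in\mathbb{R}^{m\times n}$, let $b\in\mathbb{R}^m$ be a column vector with $b\ge0$ (standing assumption), and let $c\in\mathbb{R}^n$ be a row vector. The dual linear program is $\min\{yb\mid yA\ge c,\ y\ge0\}$ with $y\in\mathbb{R}^m$ a row vector. Put $A^+=(A,I)$, an $m\times(n+m)$ matrix with columns $A^+_j$, and $c^+=(c_1,\dots,c_n,0,\dots,0)\in\mathbb{R}^{n+m}$. The dual feasible region is $D=\{y\in\mathbb{R}^m\mid yA^+_j\ge c^+_j,\ j=1,\dots,n+m\}$; its points are called feasible points. A feasible interval is a segment all of whose points are feasible.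
   Formalization: In (F2), [Q_a,Q_b] is shown feasible on the line through P; it is claimed to lie on the ray t≥0 only if t_a≥0 (false otherwise), and if t_b≥0 its part with t≥max(0,t_a) is nonempty, feasible and on the ray; max/min of an empty set are read as -∞/+∞. *)

theory Defs
  imports "HOL-Analysis.Analysis"
begin

text \<open>The indices 1, ..., n + m of the columns of the extended matrix (A, I) form the sum
  type \<open>'n + 'm\<close>: \<open>Inl\<close> for the columns of A, \<open>Inr\<close> for those of I.\<close>

definition A_plus :: "real^'n^'m \<Rightarrow> real^('n + 'm)^'m" where
  "A_plus A = (\<chi> i j. case j of Inl k \<Rightarrow> A $ i $ k | Inr k \<Rightarrow> (mat 1 :: real^'m^'m) $ i $ k)"

definition c_plus :: "real^'n \<Rightarrow> real^('n + 'm::finite)" where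
  "c_plus c = (\<chi> j. case j of Inl k \<Rightarrow> c $ k | Inr k \<Rightarrow> 0)"

definition dual_feasible :: "real^'n^'m \<Rightarrow> real^'n \<Rightarrow> (real^'m) set" where
  "dual_feasible A c = {y. \<forall>j. y \<bullet> column j (A_plus A) \<ge> c_plus c $ j}"

definition ray :: "real^'m \<Rightarrow> real^'m \<Rightarrow> (real^'m) set" where
  "ray P d = {P + t *\<^sub>R d | t. t \<ge> 0}"

definition M_coef :: "real^'n^'m \<Rightarrow> real^'n \<Rightarrow> real^'m \<Rightarrow> 'n + 'm \<Rightarrow> real" where
  "M_coef A c P j = c_plus c $ j - P \<bullet> column j (A_plus A)"

definition D_coef :: "real^'n^'m \<Rightarrow> real^'m \<Rightarrow> 'n + 'm \<Rightarrow> real" where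
  "D_coef A d j = d \<bullet> column j (A_plus A)"

definition t_coef :: "real^'n^'m \<Rightarrow> real^'n \<Rightarrow> real^'m \<Rightarrow> real^'m \<Rightarrow> 'n + 'm \<Rightarrow> real" where
  "t_coef A c P d j = M_coef A c P j / D_coef A d j"

text \<open>The maximum over the empty set is \<open>-\<infinity>\<close> and the minimum over the empty set is \<open>\<infinity>\<close>;
  for a nonempty index set the inserted infinite element has no effect.\<close>

definition t_a :: "real^'n^'m \<Rightarrow> real^'n \<Rightarrow> real^'m \<Rightarrow> real^'m \<Rightarrow> ereal" where
  "t_a A c P d = Max (insert (-\<infinity>) ((\<lambda>j. ereal (t_coef A c P d j)) ` {j. D_coef A d j > 0}))"

definition t_b :: "real^'n^'m \<Rightarrow> real^'n \<Rightarrow> real^'m \<Rightarrow> real^'m \<Rightarrow> ereal" where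
  "t_b A c P d = Min (insert \<infinity> ((\<lambda>j. ereal (t_coef A c P d j)) ` {j. D_coef A d j < 0}))"

text \<open>\<open>Q_a\<close> and \<open>Q_b\<close> are meaningful only if \<open>t_a\<close>, respectively \<open>t_b\<close>, is finite.\<close>

definition Q_a :: "real^'n^'m \<Rightarrow> real^'n \<Rightarrow> real^'m \<Rightarrow> real^'m \<Rightarrow> real^'m" where
  "Q_a A c P d = P + real_of_ereal (t_a A c P d) *\<^sub>R d"

definition Q_b :: "real^'n^'m \<Rightarrow> real^'n \<Rightarrow> real^'m \<Rightarrow> real^'m \<Rightarrow> real^'m" where
  "Q_b A c P d = P + real_of_ereal (t_b A c P d) *\<^sub>R d"

text \<open>The part of the line through P in direction d with parameter between s and u: a segment
  if both bounds are finite, and unbounded (for nonzero d) if one of them is infinite.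
  The parameters \<open>t_a\<close> and \<open>t_b\<close> can be negative, in which case \<open>Q_a\<close>, \<open>Q_b\<close> are on this line but not
  on the ray; the part on the ray is obtained with the lower bound \<open>max 0 s\<close>.\<close>

definition line_interval :: "real^'m \<Rightarrow> real^'m \<Rightarrow> ereal \<Rightarrow> ereal \<Rightarrow> (real^'m) set" where
  "line_interval P d s u = {P + t *\<^sub>R d | t. s \<le> ereal t \<and> ereal t \<le> u}"

end

theory Submission
  imports Defs
begin

text \<open>Along the line \<open>t \<mapsto> P + t d\<close> the constraint of column \<open>j\<close> is the scalar inequality
  \<open>M\<^sub>j \<le> t D\<^sub>j\<close>. According to the sign of \<open>D\<^sub>j\<close> it is a lower bound \<open>t\<^sub>j\<close> for \<open>t\<close>, an upper bound
  \<open>t\<^sub>j\<close> for \<open>t\<close>, or a condition \<open>M\<^sub>j \<le> 0\<close> that does not involve \<open>t\<close>. In the third case a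
  violated condition excludes every point of the line, which gives (F1). If none is violated, then
  \<open>P + t d\<close> is feasible exactly for \<open>t\<close> between the largest lower bound and the smallest upper
  bound (\<open>feasible_on_line_iff_between_bounds\<close>), which gives (F2). The rest translates
  parameter intervals with possibly infinite ends into subsets of the line, and, if both ends are
  finite, into the segment joining \<open>Q\<^sub>a\<close> and \<open>Q\<^sub>b\<close>.\<close>

lemma feasible_on_line_iff:
  "P + t *\<^sub>R d \<in> dual_feasible A c \<longleftrightarrow> (\<forall>j. M_coef A c P j \<le> t * D_coef A d j)"
  by (auto simp: dual_feasible_def M_coef_def D_coef_def inner_add_left algebra_simps)

lemma t_a_le_iff:
  "t_a A c P d \<le> ereal t \<longleftrightarrow> (\<forall>j. D_coef A d j > 0 \<longrightarrow> M_coef A c P j \<le> t * D_coef A d j)"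
  by (auto simp: t_a_def t_coef_def pos_divide_le_eq)

lemma le_t_b_iff:
  "ereal t \<le> t_b A c P d \<longleftrightarrow> (\<forall>j. D_coef A d j < 0 \<longrightarrow> M_coef A c P j \<le> t * D_coef A d j)"
  by (auto simp: t_b_def t_coef_def neg_le_divide_eq)

lemma feasible_on_line_iff_between_bounds:
  assumes "\<forall>j. D_coef A d j = 0 \<longrightarrow> M_coef A c P j \<le> 0"
  shows "P + t *\<^sub>R d \<in> dual_feasible A c \<longleftrightarrow> t_a A c P d \<le> ereal t \<and> ereal t \<le> t_b A c P d"
proof -
  have "M_coef A c P j \<le> t * D_coef A d j \<longleftrightarrow>
      (D_coef A d j > 0 \<longrightarrow> M_coef A c P j \<le> t * D_coef A d j) \<and>
      (D_coef A d j < 0 \<longrightarrow> M_coef A c P j \<le> t * D_coef A d j)" for j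
    using assms by (cases "D_coef A d j" "0::real" rule: linorder_cases) simp_all
  then show ?thesis
    unfolding feasible_on_line_iff t_a_le_iff le_t_b_iff by blast
qed

lemma t_a_not_PInf: "t_a A c P d \<noteq> \<infinity>"
proof -
  have "t_a A c P d \<in> insert (-\<infinity>) ((\<lambda>j. ereal (t_coef A c P d j)) ` {j. D_coef A d j > 0})"
    unfolding t_a_def by (intro Max_in) auto
  then show ?thesis by auto
qed

lemma t_b_not_MInf: "t_b A c P d \<noteq> -\<infinity>"
proof -
  have "t_b A c P d \<in> insert \<infinity> ((\<lambda>j. ereal (t_coef A c P d j)) ` {j. D_coef A d j < 0})"
    unfolding t_b_def by (intro Min_in) auto
  then show ?thesis by auto
qed

lemma t_a_finite:
  assumes "\<exists>j. D_coef A d j > 0"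
  shows "\<exists>r. t_a A c P d = ereal r"
proof -
  obtain j where "D_coef A d j > 0" using assms by blast
  then have "ereal (t_coef A c P d j) \<le> t_a A c P d"
    unfolding t_a_def by (intro Max_ge) auto
  then show ?thesis using t_a_not_PInf[of A c P d] by (cases "t_a A c P d") auto
qed

lemma t_b_finite:
  assumes "\<exists>j. D_coef A d j < 0"
  shows "\<exists>r. t_b A c P d = ereal r"
proof -
  obtain j where "D_coef A d j < 0" using assms by blast
  then have "t_b A c P d \<le> ereal (t_coef A c P d j)"
    unfolding t_b_def by (intro Min_le) auto
  then show ?thesis using t_b_not_MInf[of A c P d] by (cases "t_b A c P d") auto
qed

text \<open>The two excluded values are the ones for which an ordered pair of extended reals can enclose
  no real number.\<close>

lemma line_interval_nonempty:
  assumes "s \<le> u" "s \<noteq> \<infinity>" "u \<noteq> -\<infinity>"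
  shows "line_interval P d s u \<noteq> {}"
proof -
  have "\<exists>t. s \<le> ereal t \<and> ereal t \<le> u"
    using assms by (cases s; cases u) auto
  then show ?thesis by (auto simp: line_interval_def)
qed

lemma line_interval_subset_ray:
  assumes "0 \<le> s"
  shows "line_interval P d s u \<subseteq> ray P d"
proof -
  have "0 \<le> t" if "s \<le> ereal t" for t
    using order_trans[OF assms that] by simp
  then show ?thesis unfolding line_interval_def ray_def by blast
qed

lemma line_interval_antimono: "s \<le> s' \<Longrightarrow> line_interval P d s' u \<subseteq> line_interval P d s u"
  unfolding line_interval_def using order_trans[of s s'] by blast

text \<open>An affine map sends the segment between two parameters onto the segment between the images,
  and a segment of reals is an interval.\<close>

lemma closed_segment_eq_line_interval:
  assumes "a \<le> b"
  shows "closed_segment (P + a *\<^sub>R d) (P + b *\<^sub>R d) = line_interval P d (ereal a) (ereal b)"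
proof -
  have lin: "linear (\<lambda>t::real. t *\<^sub>R d)"
    by (intro linearI) (simp_all add: scaleR_add_left)
  have "closed_segment (P + a *\<^sub>R d) (P + b *\<^sub>R d) = (+) P ` (\<lambda>t. t *\<^sub>R d) ` closed_segment a b"
    by (simp only: closed_segment_translation closed_segment_linear_image[OF lin])
  also have "\<dots> = (\<lambda>t. P + t *\<^sub>R d) ` {a..b}"
    using assms by (simp only: image_image closed_segment_eq_real_ivl if_True)
  also have "\<dots> = line_interval P d (ereal a) (ereal b)"
    unfolding line_interval_def by (simp only: ereal_less_eq atLeastAtMost_iff[symmetric] setcompr_eq_image Collect_mem_eq)
  finally show ?thesis .
qed

theorem theorem5p1:
  fixes A :: "real^'n^'m" and b :: "real^'m" and c :: "real^'n" and P d :: "real^'m"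
  assumes "b \<ge> 0"
  shows
    "((\<exists>j. D_coef A d j = 0 \<and> M_coef A c P j > 0) \<longrightarrow> ray P d \<inter> dual_feasible A c = {})
     \<and>
     ((\<forall>j. D_coef A d j = 0 \<longrightarrow> M_coef A c P j \<le> 0) \<and> t_a A c P d \<le> t_b A c P d \<longrightarrow>
        ((\<exists>j. D_coef A d j > 0) \<and> (\<exists>j. D_coef A d j < 0) \<longrightarrow>
           closed_segment (Q_a A c P d) (Q_b A c P d) \<subseteq> dual_feasible A c
           \<and> closed_segment (Q_a A c P d) (Q_b A c P d)
               = line_interval P d (t_a A c P d) (t_b A c P d))
        \<and> line_interval P d (t_a A c P d) (t_b A c P d) \<noteq> {}
        \<and> line_interval P d (t_a A c P d) (t_b A c P d) \<subseteq> dual_feasible A c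
        \<and> (t_a A c P d \<ge> 0 \<longrightarrow>
             line_interval P d (t_a A c P d) (t_b A c P d) \<subseteq> ray P d)
        \<and> (t_b A c P d \<ge> 0 \<longrightarrow>
             line_interval P d (max 0 (t_a A c P d)) (t_b A c P d) \<noteq> {}
             \<and> line_interval P d (max 0 (t_a A c P d)) (t_b A c P d)
                 \<subseteq> ray P d \<inter> dual_feasible A c))"
proof -
  let ?a = "t_a A c P d" and ?b = "t_b A c P d"
  have F1: "ray P d \<inter> dual_feasible A c = {}"
    if violated: "\<exists>j. D_coef A d j = 0 \<and> M_coef A c P j > 0"
  proof -
    obtain j where "D_coef A d j = 0" "M_coef A c P j > 0" using violated by blast
    then have "\<not> M_coef A c P j \<le> t * D_coef A d j" for t by simp
    then have "P + t *\<^sub>R d \<notin> dual_feasible A c" for t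
      unfolding feasible_on_line_iff by blast
    then show ?thesis by (auto simp: ray_def)
  qed
  have F2:
    "((\<exists>j. D_coef A d j > 0) \<and> (\<exists>j. D_coef A d j < 0) \<longrightarrow>
        closed_segment (Q_a A c P d) (Q_b A c P d) \<subseteq> dual_feasible A c
        \<and> closed_segment (Q_a A c P d) (Q_b A c P d) = line_interval P d ?a ?b)
     \<and> line_interval P d ?a ?b \<noteq> {}
     \<and> line_interval P d ?a ?b \<subseteq> dual_feasible A c
     \<and> (?a \<ge> 0 \<longrightarrow> line_interval P d ?a ?b \<subseteq> ray P d)
     \<and> (?b \<ge> 0 \<longrightarrow> line_interval P d (max 0 ?a) ?b \<noteq> {}
          \<and> line_interval P d (max 0 ?a) ?b \<subseteq> ray P d \<inter> dual_feasible A c)"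
    if *: "\<forall>j. D_coef A d j = 0 \<longrightarrow> M_coef A c P j \<le> 0" and le: "?a \<le> ?b"
  proof -
    have feasible: "line_interval P d ?a ?b \<subseteq> dual_feasible A c"
      using feasible_on_line_iff_between_bounds[OF *] by (auto simp: line_interval_def)
    have nonempty: "line_interval P d ?a ?b \<noteq> {}"
      by (rule line_interval_nonempty[OF le t_a_not_PInf t_b_not_MInf])
    have segment: "closed_segment (Q_a A c P d) (Q_b A c P d) = line_interval P d ?a ?b"
      if pos: "\<exists>j. D_coef A d j > 0" and neg: "\<exists>j. D_coef A d j < 0"
    proof -
      obtain r s where rs: "?a = ereal r" "?b = ereal s"
        using t_a_finite[OF pos] t_b_finite[OF neg] by blast
      then have "r \<le> s" using le by simp
      then show ?thesis using rs by (simp add: Q_a_def Q_b_def closed_segment_eq_line_interval)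
    qed
    have "max 0 ?a \<noteq> \<infinity>" using t_a_not_PInf[of A c P d] by (simp add: max_def)
    then have nonempty0: "line_interval P d (max 0 ?a) ?b \<noteq> {}" if "?b \<ge> 0"
      using that le t_b_not_MInf by (intro line_interval_nonempty) simp_all
    have "line_interval P d (max 0 ?a) ?b \<subseteq> ray P d \<inter> dual_feasible A c"
      using line_interval_subset_ray[OF max.cobounded1]
        order_trans[OF line_interval_antimono[OF max.cobounded2] feasible]
      by (rule Int_greatest)
    then show ?thesis
      using feasible nonempty segment nonempty0 line_interval_subset_ray[of ?a P d ?b] by simp
  qed
  show ?thesis
    by (rule conjI; rule impI; (elim conjE)?) (erule F1, erule (1) F2)
qed

end
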